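(* Let $n,m,T\ge 1$ be integers, let $A\in\mathbb{R}^{n\times n}$, $B\in\mathbb{R}^{n\times m}$ with $(A,B)$ controllable, and let $\{u(k)\}_{k=0}^{T-1}\subset\mathbb{R}^m$, $\{x(k)\}_{k=0}^{T}\subset\mathbb{R}^n$ satisfy $x(k+1)=Ax(k)+Bu(k)$ for $k=0,\dots,T-1$. Assume that $\{u(k)\}_{k=0}^{T-1}$ is persistently exciting of order $n+1$. Let $\delta\in\mathbb{R}$ satisfy $|\delta|\ge 2$, and let the poisoned state data matrices be $$\tilde X_+ = X_+ + \delta X_-,\qquad \tilde X_- = X_-.$$ Then the attack is effective for destabilization; that is, for every $K\in\mathbb{R}^{m\times n}$ that stabilizes the open-loop system consistent with the poisoned dataset $(U,\tilde X_-,\tilde X_+)$, the matrix $A+BK$ is not Schur stable.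
   Context: Persistent excitation: a sequence $\{w(k)\}_{k=0}^{T-1}$, $w(k)\in\mathbb{R}^q$, is persistently exciting of order $L$ if its Hankel matrix of depth $L$, namely the $qL\times(T-L+1)$ real matrix whose $j$-th column ($j=0,\dots,T-L$) is the stacked vector $(w(j),w(j+1),\dots,w(j+L-1))$, has rank $qL$ (full row rank). Data matrices: $U=[u(0)\ u(1)\cdots u(T-1)]\in\mathbb{R}^{m\times T}$, $X_-=[x(0)\ x(1)\cdots x(T-1)]\in\mathbb{R}^{n\times T}$, $X_+=[x(1)\ x(2)\cdots x(T)]\in\mathbb{R}^{n\times T}$. The poisoned state data are matrices $\tilde X_-,\tilde X_+\in\mathbb{R}^{n\times T}$ that replace $X_-,X_+$; the input data $U$ are unchanged. System consistent with a dataset: the open-loop system consistent with $(U,\tilde X_-,\tilde X_+)$ is $x(k+1)=\tilde A x(k)+\tilde B u(k)$, where $(\tilde A,\tilde B)\in\mathbb{R}^{n\times n}\times\mathbb{R}^{n\times m}$ is the pair satisfying $\tilde X_+=\tilde A\tilde X_-+\tilde B U$ (in the setting considered, this pair exists and is unique). The matrix $K$ stabilizes this system if $\tilde A+\tilde B K$ is Schur stable. Schur stable: all (complex) eigenvalues of the matrix have modulus strictly less than $1$. *)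

theory Defs
  imports
    "Jordan_Normal_Form.DL_Rank"
    "Jordan_Normal_Form.Spectral_Radius"
begin

definition trajectory ::
  "nat \<Rightarrow> nat \<Rightarrow> real mat \<Rightarrow> real mat \<Rightarrow> nat \<Rightarrow> (nat \<Rightarrow> real vec) \<Rightarrow> (nat \<Rightarrow> real vec) \<Rightarrow> bool"
  where
  "trajectory n m A B T u x \<longleftrightarrow>
     (\<forall>k<T. u k \<in> carrier_vec m) \<and>
     (\<forall>k\<le>T. x k \<in> carrier_vec n) \<and>
     (\<forall>k<T. x (Suc k) = A *\<^sub>v x k + B *\<^sub>v u k)"

text \<open>
  Controllability in Kalman's sense: every initial state can be steered to every target state
  in finitely many steps.
\<close>
definition controllable :: "nat \<Rightarrow> nat \<Rightarrow> real mat \<Rightarrow> real mat \<Rightarrow> bool" where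
  "controllable n m A B \<longleftrightarrow>
     (\<forall>x0 \<in> carrier_vec n. \<forall>xf \<in> carrier_vec n.
        \<exists>N u x. trajectory n m A B N u x \<and> x 0 = x0 \<and> x N = xf)"

text \<open>
  The entry in row \<open>i\<close> of the stacked vector \<open>(w(j), \<dots>, w(j + L - 1))\<close> is the
  component \<open>i mod q\<close> of the block \<open>w(j + i div q)\<close>. The number of columns
  \<open>T - L + 1\<close> is written \<open>T + 1 - L\<close>, so that truncated subtraction yields an
  empty matrix when \<open>L > T\<close>.
\<close>
definition hankel_mat :: "nat \<Rightarrow> nat \<Rightarrow> nat \<Rightarrow> (nat \<Rightarrow> real vec) \<Rightarrow> real mat" where
  "hankel_mat q L T w = mat (q * L) (T + 1 - L) (\<lambda>(i, j). w (j + i div q) $ (i mod q))"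

definition persistently_exciting :: "nat \<Rightarrow> nat \<Rightarrow> nat \<Rightarrow> (nat \<Rightarrow> real vec) \<Rightarrow> bool" where
  "persistently_exciting q L T w \<longleftrightarrow> vec_space.rank (q * L) (hankel_mat q L T w) = q * L"

text \<open>The \<open>q \<times> T\<close> matrix \<open>[w(s) w(s + 1) \<cdots> w(s + T - 1)]\<close>.\<close>
definition data_mat :: "nat \<Rightarrow> nat \<Rightarrow> nat \<Rightarrow> (nat \<Rightarrow> real vec) \<Rightarrow> real mat" where
  "data_mat q s T w = mat_of_cols q (map w [s..<s + T])"

definition schur_stable :: "real mat \<Rightarrow> bool" where
  "schur_stable M \<longleftrightarrow> (\<forall>\<mu>. eigenvalue (map_mat complex_of_real M) \<mu> \<longrightarrow> cmod \<mu> < 1)"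

definition is_consistent_system ::
  "nat \<Rightarrow> nat \<Rightarrow> real mat \<Rightarrow> real mat \<Rightarrow> real mat \<Rightarrow> real mat \<times> real mat \<Rightarrow> bool" where
  "is_consistent_system n m U Xm Xp S \<longleftrightarrow>
     (case S of (A, B) \<Rightarrow>
        A \<in> carrier_mat n n \<and> B \<in> carrier_mat n m \<and> Xp = A * Xm + B * U)"

text \<open>
  Meaningful only for datasets with exactly one consistent pair; statements using this
  constant should therefore also assert unique existence.
\<close>
definition consistent_system ::
  "nat \<Rightarrow> nat \<Rightarrow> real mat \<Rightarrow> real mat \<Rightarrow> real mat \<Rightarrow> real mat \<times> real mat" where
  "consistent_system n m U Xm Xp = (THE S. is_consistent_system n m U Xm Xp S)"

definition stabilizes :: "real mat \<Rightarrow> real mat \<times> real mat \<Rightarrow> bool" where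
  "stabilizes K S \<longleftrightarrow> (case S of (A, B) \<Rightarrow> schur_stable (A + B * K))"

end

theory Submission
  imports Defs
begin

text \<open>
  By Willems' fundamental lemma the stacked data matrix of states and inputs has full row rank,
  so \<open>(A + \<delta> I, B)\<close> is the only system consistent with the poisoned data. Closing the loop
  with \<open>K\<close> gives \<open>(A + B K) + \<delta> I\<close>, whose spectrum is that of \<open>A + B K\<close> translated by
  \<open>\<delta>\<close>; as \<open>\<bar>\<delta>\<bar> \<ge> 2\<close>, an eigenvalue and its translate cannot both lie in the open unit
  disc.
\<close>

section \<open>Full row rank as triviality of the left kernel\<close>

text \<open>A maximal linearly independent set of columns has as many elements as the rank, hence is
  a basis. A vector orthogonal to a basis is orthogonal to every unit vector.\<close>

lemma (in vec_space) full_rank_left_kernel_trivial: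
  assumes M: "M \<in> carrier_mat n nc" and rank: "rank M = n"
    and v: "v \<in> carrier_vec n" and orth: "\<And>j. j < nc \<Longrightarrow> v \<bullet> col M j = 0"
  shows "v = 0\<^sub>v n"
proof -
  let ?P = "\<lambda>S. S \<subseteq> set (cols M) \<and> lin_indpt S"
  obtain S where S: "maximal S ?P" "finite S"
    using maximal_exists_superset[of "set (cols M)" ?P "{}"] finite_lin_indpt2[of "{}"] by auto
  then have sub: "S \<subseteq> set (cols M)" and li: "lin_indpt S"
    by (auto simp: maximal_def)
  have colsM: "set (cols M) \<subseteq> carrier_vec n"
    using M cols_dim by blast
  with sub have Sc: "S \<subseteq> carrier_vec n" by blast
  have "card S = n"
    using rank_card_indpt[OF M S(1)] rank by simp
  then have "basis S"
    using dim_li_is_basis[OF fin_dim S(2) _ li] Sc dim_is_n by simp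
  then have span: "span S = carrier_vec n"
    by (simp add: basis_def)
  have "v \<in> orthogonal_complement S"
    unfolding orthogonal_complement_def
    using v orth sub M by (auto simp: cols_def)
  then have *: "v \<bullet> w = 0" if "w \<in> carrier_vec n" for w
    using that in_orthogonal_complement_span[OF Sc] span unfolding orthogonal_complement_def by auto
  show ?thesis
  proof (rule eq_vecI)
    fix i assume "i < dim_vec (0\<^sub>v n)"
    then show "v $ i = 0\<^sub>v n $ i"
      using *[OF unit_vec_carrier[of n i]] scalar_prod_right_unit[of i n v] v by simp
  qed (use v in simp)
qed

text \<open>Stacking the blocks \<open>g r\<close> gives a vector orthogonal to every column of the
  Hankel matrix, so full row rank kills it. This is the form in which excitation is used
  below.\<close>

lemma persistently_exciting_left_kernel_trivial:
  assumes pe: "persistently_exciting q L T w"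
    and g: "\<And>r. r < L \<Longrightarrow> g r \<in> carrier_vec q"
    and w: "\<And>k. k < T \<Longrightarrow> w k \<in> carrier_vec q"
    and orth: "\<And>k. k + L \<le> T \<Longrightarrow> (\<Sum>r<L. g r \<bullet> w (k + r)) = 0"
    and r: "r < L"
  shows "g r = 0\<^sub>v q"
proof -
  interpret vec_space "TYPE(real)" "q * L" .
  let ?H = "hankel_mat q L T w"
  \<comment> \<open>The index convention is that of the rows of \<open>hankel_mat\<close>: entry
    \<open>i mod q\<close> of block \<open>i div q\<close>.\<close>
  define v where "v = vec (q * L) (\<lambda>i. g (i div q) $ (i mod q))"
  have "v = 0\<^sub>v (q * L)"
  proof (rule full_rank_left_kernel_trivial)
    show H: "?H \<in> carrier_mat (q * L) (T + 1 - L)" by (simp add: hankel_mat_def)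
    show "rank ?H = q * L" using pe by (simp add: persistently_exciting_def)
    show "v \<in> carrier_vec (q * L)" by (simp add: v_def)
    fix j assume j: "j < T + 1 - L"
    have "v \<bullet> col ?H j =
        (\<Sum>i<L * q. g (i div q) $ (i mod q) * w (j + i div q) $ (i mod q))"
      using j by (simp add: scalar_prod_def v_def hankel_mat_def lessThan_atLeast0 mult.commute)
    \<comment> \<open>The index range is cut into \<open>L\<close> consecutive blocks of length
      \<open>q\<close>; block \<open>r\<close> contributes one scalar product.\<close>
    also have "\<dots> = (\<Sum>r<L. \<Sum>i = r * q..<r * q + q.
        g (i div q) $ (i mod q) * w (j + i div q) $ (i mod q))"
      by (rule sum.nat_group[symmetric])
    also have "\<dots> = (\<Sum>r<L. g r \<bullet> w (j + r))"
    proof (rule sum.cong[OF refl])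
      fix r assume "r \<in> {..<L}"
      with w[of "j + r"] j have c: "dim_vec (w (j + r)) = q" by auto
      have "(\<Sum>i = r * q..<r * q + q. g (i div q) $ (i mod q) * w (j + i div q) $ (i mod q))
          = (\<Sum>i = 0..<q. g ((i + r * q) div q) $ ((i + r * q) mod q)
              * w (j + (i + r * q) div q) $ ((i + r * q) mod q))"
        using sum.shift_bounds_nat_ivl
          [of "\<lambda>i. g (i div q) $ (i mod q) * w (j + i div q) $ (i mod q)" 0 "r * q" q]
        by (simp add: add.commute)
      also have "\<dots> = g r \<bullet> w (j + r)"
        unfolding scalar_prod_def c by (rule sum.cong) auto
      finally show "(\<Sum>i = r * q..<r * q + q.
          g (i div q) $ (i mod q) * w (j + i div q) $ (i mod q)) = g r \<bullet> w (j + r)" .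
    qed
    also have "\<dots> = 0" using j by (intro orth) auto
    finally show "v \<bullet> col ?H j = 0" .
  qed
  show ?thesis
  proof (rule eq_vecI)
    fix i assume "i < dim_vec (0\<^sub>v q :: real vec)"
    then have i: "i < q" by simp
    have "i + r * q < q + r * q" using i by simp
    also have "\<dots> \<le> q * L"
      using mult_le_mono2[of "Suc r" L q] r by (simp add: algebra_simps)
    finally have "i + r * q < q * L" .
    moreover from this have "v $ (i + r * q) = 0" using \<open>v = 0\<^sub>v (q * L)\<close> by simp
    ultimately show "g r $ i = 0\<^sub>v q $ i" using i by (simp add: v_def)
  qed (use g r in auto)
qed

section \<open>Dual orbits along trajectories, and controllability\<close>

text \<open>Column form of the row vectors \<open>\<xi>\<^sup>T A\<^sup>i\<close>.\<close>
definition dual_orbit :: "real mat \<Rightarrow> real vec \<Rightarrow> nat \<Rightarrow> real vec" where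
  "dual_orbit A \<xi> i = ((\<lambda>v. A\<^sup>T *\<^sub>v v) ^^ i) \<xi>"

lemma dual_orbit_0 [simp]: "dual_orbit A \<xi> 0 = \<xi>"
  and dual_orbit_Suc: "dual_orbit A \<xi> (Suc i) = A\<^sup>T *\<^sub>v dual_orbit A \<xi> i"
  by (simp_all add: dual_orbit_def)

lemma dual_orbit_carrier [simp]:
  "A \<in> carrier_mat n n \<Longrightarrow> \<xi> \<in> carrier_vec n \<Longrightarrow> dual_orbit A \<xi> i \<in> carrier_vec n"
  by (induction i) (auto simp: dual_orbit_Suc intro!: mult_mat_vec_carrier)

lemma dual_orbit_Suc_scalar_prod:
  assumes "A \<in> carrier_mat n n" "\<xi> \<in> carrier_vec n" "w \<in> carrier_vec n"
  shows "dual_orbit A \<xi> (Suc i) \<bullet> w = dual_orbit A \<xi> i \<bullet> (A *\<^sub>v w)"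
  using assms by (simp add: dual_orbit_Suc transpose_vec_mult_scalar[of A n n])

lemma dual_orbit_step:
  assumes A: "A \<in> carrier_mat n n" and B: "B \<in> carrier_mat n m" and \<xi>: "\<xi> \<in> carrier_vec n"
    and tr: "trajectory n m A B T u x" and k: "k < T"
  shows "dual_orbit A \<xi> i \<bullet> x (Suc k) =
    dual_orbit A \<xi> (Suc i) \<bullet> x k + dual_orbit A \<xi> i \<bullet> (B *\<^sub>v u k)"
proof -
  have "x k \<in> carrier_vec n" "u k \<in> carrier_vec m" "x (Suc k) = A *\<^sub>v x k + B *\<^sub>v u k"
    using tr k by (auto simp: trajectory_def)
  then show ?thesis
    using A B \<xi> by (simp add: dual_orbit_Suc_scalar_prod
        scalar_prod_add_distrib[of _ n] mult_mat_vec_carrier[of _ n])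
qed

text \<open>The variation of constants formula, paired with a dual orbit. The induction peels off
  the last time step, which raises the orbit index by one; hence \<open>j\<close> is kept
  arbitrary.\<close>

lemma dual_orbit_steps:
  assumes A: "A \<in> carrier_mat n n" and B: "B \<in> carrier_mat n m" and \<xi>: "\<xi> \<in> carrier_vec n"
    and tr: "trajectory n m A B T u x" and k: "k + i \<le> T"
  shows "dual_orbit A \<xi> j \<bullet> x (k + i) = dual_orbit A \<xi> (j + i) \<bullet> x k
    + (\<Sum>r<i. dual_orbit A \<xi> (j + i - Suc r) \<bullet> (B *\<^sub>v u (k + r)))"
  using k
proof (induction i arbitrary: j)
  case (Suc i)
  have "dual_orbit A \<xi> j \<bullet> x (k + Suc i) =
      dual_orbit A \<xi> (Suc j) \<bullet> x (k + i) + dual_orbit A \<xi> j \<bullet> (B *\<^sub>v u (k + i))"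
    using dual_orbit_step[OF A B \<xi> tr] Suc.prems by simp
  also have "dual_orbit A \<xi> (Suc j) \<bullet> x (k + i) = dual_orbit A \<xi> (Suc j + i) \<bullet> x k
    + (\<Sum>r<i. dual_orbit A \<xi> (Suc j + i - Suc r) \<bullet> (B *\<^sub>v u (k + r)))"
    using Suc.IH Suc.prems by simp
  finally show ?case by (simp add: algebra_simps)
qed simp

text \<open>From the origin only combinations of vectors \<open>A^i B w\<close> can be reached, and
  \<xi> annihilates all of them. Since every unit vector is reachable, every entry of \<xi>
  vanishes.\<close>

lemma controllable_dual:
  assumes A: "A \<in> carrier_mat n n" and B: "B \<in> carrier_mat n m" and \<xi>: "\<xi> \<in> carrier_vec n"
    and ctrl: "controllable n m A B"
    and zero: "\<And>i w. w \<in> carrier_vec m \<Longrightarrow> dual_orbit A \<xi> i \<bullet> (B *\<^sub>v w) = 0"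
  shows "\<xi> = 0\<^sub>v n"
proof (rule eq_vecI)
  fix l assume "l < dim_vec (0\<^sub>v n :: real vec)"
  then have l: "l < n" by simp
  obtain N u x where tr: "trajectory n m A B N u x" and x: "x 0 = 0\<^sub>v n" "x N = unit_vec n l"
    using ctrl unfolding controllable_def by (meson unit_vec_carrier zero_carrier_vec)
  have u: "u k \<in> carrier_vec m" if "k < N" for k
    using tr that by (simp add: trajectory_def)
  have "\<xi> \<bullet> x N = 0"
    using dual_orbit_steps[OF A B \<xi> tr, of 0 N 0] A \<xi> x(1) u zero by simp
  then show "\<xi> $ l = 0\<^sub>v n $ l"
    using x(2) l scalar_prod_right_unit[of l n \<xi>] by simp
qed (use \<xi> in simp)

section \<open>Willems' fundamental lemma\<close>

text \<open>Any \<open>n + 1\<close> vectors in dimension \<open>n\<close> are dependent. The index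
  \<open>d\<close> of the last nonzero coefficient is recorded because it provides the pivot when
  the Hankel relation is solved block by block.\<close>

lemma exists_vanishing_combination:
  fixes s :: "nat \<Rightarrow> 'a :: field vec"
  assumes s: "\<And>i. s i \<in> carrier_vec n"
  obtains c d where "d \<le> n" "c d \<noteq> 0" "\<And>i. d < i \<Longrightarrow> i \<le> n \<Longrightarrow> c i = 0"
    "\<And>w. w \<in> carrier_vec n \<Longrightarrow> (\<Sum>i\<le>n. c i * (s i \<bullet> w)) = 0"
proof -
  \<comment> \<open>The vectors are the columns; a zero row is appended to make the matrix square.
    The last unit vector then lies in the kernel of the transpose, so \<open>M\<close> is singular
    and a kernel vector supplies the coefficients.\<close>
  define M where "M = mat (Suc n) (Suc n) (\<lambda>(l, i). if l < n then s i $ l else 0)"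
  have M: "M \<in> carrier_mat (Suc n) (Suc n)" by (simp add: M_def)
  have "M\<^sup>T *\<^sub>v unit_vec (Suc n) n = 0\<^sub>v (Suc n)"
  proof (rule eq_vecI)
    fix i assume "i < dim_vec (0\<^sub>v (Suc n))"
    then show "(M\<^sup>T *\<^sub>v unit_vec (Suc n) n) $ i = 0\<^sub>v (Suc n) $ i"
      using M scalar_prod_right_unit[of n "Suc n" "col M i"] by (simp add: M_def)
  qed (use M in simp)
  then have "det M\<^sup>T = 0"
    using det_0_iff_vec_prod_zero_field[of "M\<^sup>T" "Suc n"] M
    by (metis transpose_carrier_mat unit_vec_carrier unit_vec_nonzero lessI)
  then obtain v where v: "v \<in> carrier_vec (Suc n)" "v \<noteq> 0\<^sub>v (Suc n)" "M *\<^sub>v v = 0\<^sub>v (Suc n)"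
    using det_0_iff_vec_prod_zero_field[OF M] det_transpose[OF M] by auto
  define I where "I = {i. i \<le> n \<and> v $ i \<noteq> 0}"
  have "I \<noteq> {}"
  proof
    assume "I = {}"
    then have "v = 0\<^sub>v (Suc n)" using v(1) by (intro eq_vecI) (auto simp: I_def)
    with v(2) show False ..
  qed
  moreover have "finite I" by (simp add: I_def)
  ultimately have "Max I \<in> I" and max: "\<And>i. i \<in> I \<Longrightarrow> i \<le> Max I"
    by auto
  have comp: "(\<Sum>i\<le>n. v $ i * s i $ l) = 0" if l: "l < n" for l
  proof -
    have "(M *\<^sub>v v) $ l = (\<Sum>i\<le>n. v $ i * s i $ l)"
      using M v(1) l
      by (simp add: M_def scalar_prod_def atLeast0LessThan lessThan_Suc_atMost mult.commute
          del: sum.op_ivl_Suc sum.lessThan_Suc)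
    then show ?thesis using v(3) l by simp
  qed
  show ?thesis
  proof
    show "Max I \<le> n" "v $ Max I \<noteq> 0" using \<open>Max I \<in> I\<close> by (auto simp: I_def)
    show "v $ i = 0" if "Max I < i" "i \<le> n" for i
    proof (rule ccontr)
      assume "v $ i \<noteq> 0"
      with that(2) have "i \<in> I" by (simp add: I_def)
      with max that(1) show False by (simp add: not_le[symmetric])
    qed
    fix w :: "'a vec" assume w: "w \<in> carrier_vec n"
    have "(\<Sum>i\<le>n. v $ i * (s i \<bullet> w)) = (\<Sum>i\<le>n. \<Sum>l<n. v $ i * s i $ l * w $ l)"
      using w by (simp add: scalar_prod_def sum_distrib_left lessThan_atLeast0 mult.assoc)
    also have "\<dots> = (\<Sum>l<n. (\<Sum>i\<le>n. v $ i * s i $ l) * w $ l)"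
      by (subst sum.swap) (simp add: sum_distrib_right)
    also have "\<dots> = 0" using comp by simp
    finally show "(\<Sum>i\<le>n. v $ i * (s i \<bullet> w)) = 0" .
  qed
qed

text \<open>
  Willems' fundamental lemma. A relation \<open>\<xi>\<^sup>T x(k) + \<eta>\<^sup>T u(k) = 0\<close>, shifted by
  \<open>0, \<dots>, n\<close> steps and combined with the coefficients of a linear dependence among
  \<open>\<xi>\<^sup>T, \<xi>\<^sup>T A, \<dots>, \<xi>\<^sup>T A\<^sup>n\<close>, loses its state part and so becomes a relation among
  the rows of the Hankel matrix of \<open>u\<close>. Reading off its blocks from the last to the first gives
  \<open>\<eta> = 0\<close> and \<open>\<xi>\<^sup>T A\<^sup>i B = 0\<close>.
\<close>
lemma state_input_data_left_kernel_trivial: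
  assumes A: "A \<in> carrier_mat n n" and B: "B \<in> carrier_mat n m"
    and ctrl: "controllable n m A B" and tr: "trajectory n m A B T u x"
    and pe: "persistently_exciting m (n + 1) T u"
    and \<xi>: "\<xi> \<in> carrier_vec n" and \<eta>: "\<eta> \<in> carrier_vec m"
    and rel: "\<And>k. k < T \<Longrightarrow> \<xi> \<bullet> x k + \<eta> \<bullet> u k = 0"
  shows "\<xi> = 0\<^sub>v n" "\<eta> = 0\<^sub>v m"
proof -
  let ?s = "dual_orbit A \<xi>"
  have s: "?s i \<in> carrier_vec n" for i using A \<xi> by simp
  have u: "u k \<in> carrier_vec m" if "k < T" for k using tr that by (simp add: trajectory_def)
  have xc: "x k \<in> carrier_vec n" if "k \<le> T" for k using tr that by (simp add: trajectory_def)
  \<comment> \<open>As a row vector, \<open>p i\<close> is \<xi>^T A^i B.\<close>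
  define p where "p i = B\<^sup>T *\<^sub>v ?s i" for i
  have p: "p i \<bullet> w = ?s i \<bullet> (B *\<^sub>v w)" if "w \<in> carrier_vec m" for i w
    unfolding p_def by (rule transpose_vec_mult_scalar[OF B that s])
  obtain c d where d: "d \<le> n" "c d \<noteq> 0" and above: "\<And>i. d < i \<Longrightarrow> i \<le> n \<Longrightarrow> c i = 0"
    and dep: "\<And>w. w \<in> carrier_vec n \<Longrightarrow> (\<Sum>i\<le>n. c i * (?s i \<bullet> w)) = 0"
    by (rule exists_vanishing_combination[of ?s n, OF s]) (rule that)

  \<comment> \<open>\<open>g r\<close> collects the coefficients of \<open>u (k + r)\<close> in the
    combined relation: the shift by \<open>r\<close> contributes \<eta>, and each longer shift
    \<open>i\<close> contributes \<open>p (i - Suc r)\<close> after its state is traced back to time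
    \<open>k\<close>.\<close>
  define g where "g r = vec m (\<lambda>l. c r * \<eta> $ l + (\<Sum>i\<in>{r<..n}. c i * p (i - Suc r) $ l))" for r
  have g: "g r \<bullet> w = c r * (\<eta> \<bullet> w) + (\<Sum>i\<in>{r<..n}. c i * (p (i - Suc r) \<bullet> w))"
    if w: "w \<in> carrier_vec m" for r w
  proof -
    have "g r \<bullet> w = (\<Sum>l<m. c r * \<eta> $ l * w $ l)
        + (\<Sum>l<m. \<Sum>i\<in>{r<..n}. c i * p (i - Suc r) $ l * w $ l)"
      using w by (simp add: g_def scalar_prod_def lessThan_atLeast0 distrib_right sum.distrib
          sum_distrib_right)
    also have "(\<Sum>l<m. \<Sum>i\<in>{r<..n}. c i * p (i - Suc r) $ l * w $ l)
        = (\<Sum>i\<in>{r<..n}. \<Sum>l<m. c i * p (i - Suc r) $ l * w $ l)"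
      by (rule sum.swap)
    finally show ?thesis
      using w by (simp add: scalar_prod_def lessThan_atLeast0 sum_distrib_left mult.assoc)
  qed
  have g0: "g r = 0\<^sub>v m" if "r \<le> n" for r
  proof (rule persistently_exciting_left_kernel_trivial[OF pe])
    show "g r \<in> carrier_vec m" for r by (simp add: g_def)
    show "r < n + 1" using that by simp
    fix k assume k: "k + (n + 1) \<le> T"
    have uk: "u (k + r) \<in> carrier_vec m" if "r \<le> n" for r using u k that by simp
    \<comment> \<open>The relation at time \<open>k + i\<close>, with its state expressed through
      \<open>x k\<close> and the inputs in between.\<close>
    have eq: "?s i \<bullet> x k + (\<Sum>r<i. p (i - Suc r) \<bullet> u (k + r)) + \<eta> \<bullet> u (k + i) = 0"
      if "i \<le> n" for i
    proof -
      have "\<xi> \<bullet> x (k + i) = ?s i \<bullet> x k + (\<Sum>r<i. ?s (i - Suc r) \<bullet> (B *\<^sub>v u (k + r)))"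
        using dual_orbit_steps[OF A B \<xi> tr, of k i 0] k that by simp
      also have "(\<Sum>r<i. ?s (i - Suc r) \<bullet> (B *\<^sub>v u (k + r))) = (\<Sum>r<i. p (i - Suc r) \<bullet> u (k + r))"
        using that uk by (intro sum.cong) (auto simp: p)
      finally show ?thesis using rel[of "k + i"] k that by simp
    qed
    have "(\<Sum>r\<le>n. g r \<bullet> u (k + r)) =
        (\<Sum>r\<le>n. c r * (\<eta> \<bullet> u (k + r)))
        + (\<Sum>r\<le>n. \<Sum>i\<in>{r<..n}. c i * (p (i - Suc r) \<bullet> u (k + r)))"
      using uk by (simp add: g sum.distrib)
    \<comment> \<open>Both sides sum over the triangle of pairs with \<open>r < i\<close> and
      \<open>i \<le> n\<close>.\<close>
    also have "(\<Sum>r\<le>n. \<Sum>i\<in>{r<..n}. c i * (p (i - Suc r) \<bullet> u (k + r)))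
        = (\<Sum>i\<le>n. \<Sum>r<i. c i * (p (i - Suc r) \<bullet> u (k + r)))"
      unfolding sum.Sigma[OF finite_atMost ballI[OF finite_greaterThanAtMost]]
        sum.Sigma[OF finite_atMost ballI[OF finite_lessThan]]
      by (rule sum.reindex_bij_witness[of _ prod.swap prod.swap]) auto
    also have "(\<Sum>r\<le>n. c r * (\<eta> \<bullet> u (k + r)))
          + (\<Sum>i\<le>n. \<Sum>r<i. c i * (p (i - Suc r) \<bullet> u (k + r)))
        = (\<Sum>i\<le>n. c i * (\<eta> \<bullet> u (k + i) + (\<Sum>r<i. p (i - Suc r) \<bullet> u (k + r))))"
      by (simp add: sum.distrib distrib_left sum_distrib_left)
    \<comment> \<open>By \<open>eq\<close> only state terms remain, and these cancel by the choice
      of \<open>c\<close>.\<close>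
    also have "\<dots> = (\<Sum>i\<le>n. - (c i * (?s i \<bullet> x k)))"
    proof (rule sum.cong[OF refl])
      fix i assume "i \<in> {..n}"
      then have "\<eta> \<bullet> u (k + i) + (\<Sum>r<i. p (i - Suc r) \<bullet> u (k + r)) = - (?s i \<bullet> x k)"
        using eq[of i] by simp
      then show "c i * (\<eta> \<bullet> u (k + i) + (\<Sum>r<i. p (i - Suc r) \<bullet> u (k + r)))
          = - (c i * (?s i \<bullet> x k))" by simp
    qed
    also have "\<dots> = 0" using dep[of "x k"] xc[of k] k by (simp add: sum_negf)
    finally show "(\<Sum>r<n + 1. g r \<bullet> u (k + r)) = 0"
      by (simp add: lessThan_Suc_atMost del: sum.lessThan_Suc)
  qed (use u in simp)
  have block: "c r * (\<eta> \<bullet> w) + (\<Sum>i\<in>{r<..n}. c i * (p (i - Suc r) \<bullet> w)) = 0"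
    if "r \<le> n" "w \<in> carrier_vec m" for r w
    using g[OF that(2), of r] g0[OF that(1)] that(2) by simp

  \<comment> \<open>In block \<open>d\<close> all coefficients beyond \<open>c d\<close> vanish,
    which isolates \<eta>.\<close>
  have \<eta>0: "\<eta> \<bullet> w = 0" if "w \<in> carrier_vec m" for w
    using block[OF d(1) that] d(2) above by simp
  show "\<eta> = 0\<^sub>v m"
  proof (rule eq_vecI)
    fix l assume "l < dim_vec (0\<^sub>v m :: real vec)"
    then show "\<eta> $ l = 0\<^sub>v m $ l"
      using \<eta>0[OF unit_vec_carrier[of m l]] scalar_prod_right_unit[of l m \<eta>] by simp
  qed (use \<eta> in simp)

  \<comment> \<open>The dependence survives multiplication by powers of the transpose of
    \<open>A\<close>, so the dual orbit satisfies a linear recurrence.\<close>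
  have shift: "(\<Sum>i\<le>n. c i * (?s (i + q) \<bullet> w)) = 0" if "w \<in> carrier_vec n" for q w
    using that
  proof (induction q arbitrary: w)
    case (Suc q)
    then show ?case
      using dual_orbit_Suc_scalar_prod[OF A \<xi> Suc.prems] Suc.IH[of "A *\<^sub>v w"] A
      by (simp add: mult_mat_vec_carrier[of _ n])
  qed (simp add: dep)
  \<comment> \<open>Strong induction on \<open>t\<close>: below \<open>d\<close> the value is read
    off a block of the Hankel relation, from \<open>d\<close> on the recurrence \<open>shift\<close>
    takes over.\<close>
  have "p t \<bullet> w = 0" if w: "w \<in> carrier_vec m" for t w
  proof (induction t rule: less_induct)
    case (less t)
    show ?case
    proof (cases "t < d")
      case True
      \<comment> \<open>In this block the index \<open>i = d\<close> carries \<open>c d\<close>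
        times \<open>p t\<close>; smaller \<open>i\<close> give earlier terms, zero by induction,
        and larger \<open>i\<close> have zero coefficient.\<close>
      define r where "r = d - Suc t"
      have r: "r < d" "r \<le> n" "d - Suc r = t" using True d(1) by (auto simp: r_def)
      have "(\<Sum>i\<in>{r<..n}. c i * (p (i - Suc r) \<bullet> w)) = (\<Sum>i\<in>{d}. c i * (p (i - Suc r) \<bullet> w))"
      proof (rule sum.mono_neutral_right)
        show "\<forall>i\<in>{r<..n} - {d}. c i * (p (i - Suc r) \<bullet> w) = 0"
        proof
          fix i assume i: "i \<in> {r<..n} - {d}"
          show "c i * (p (i - Suc r) \<bullet> w) = 0"
          proof (cases "d < i")
            case False
            then have "i - Suc r < t" using i r by auto
            then show ?thesis using less.IH by simp
          qed (use above i in simp)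
        qed
      qed (use r d in auto)
      then show ?thesis using block[OF r(2) w] \<eta>0[OF w] d(2) r(3) by simp
    next
      case False
      \<comment> \<open>Shifting the dependence by \<open>t - d\<close> puts \<open>p t\<close> at
        the pivot \<open>i = d\<close>.\<close>
      then have t: "t = d + (t - d)" by simp
      have "0 = (\<Sum>i\<le>n. c i * (p (i + (t - d)) \<bullet> w))"
        using shift[of "B *\<^sub>v w" "t - d"] p[OF w] B w by (simp add: mult_mat_vec_carrier[of _ n])
      also have "\<dots> = (\<Sum>i\<in>{d}. c i * (p (i + (t - d)) \<bullet> w))"
      proof (rule sum.mono_neutral_right)
        show "\<forall>i\<in>{..n} - {d}. c i * (p (i + (t - d)) \<bullet> w) = 0"
        proof
          fix i assume i: "i \<in> {..n} - {d}"
          show "c i * (p (i + (t - d)) \<bullet> w) = 0"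
          proof (cases "d < i")
            case False
            then have "i + (t - d) < t" using i t by auto
            then show ?thesis using less.IH by simp
          qed (use above i in simp)
        qed
      qed (use d in auto)
      finally show ?thesis using d(2) t by simp
    qed
  qed
  then show "\<xi> = 0\<^sub>v n"
    using p by (intro controllable_dual[OF A B \<xi> ctrl]) simp
qed

section \<open>Uniqueness of the system behind the data\<close>

text \<open>Each row of the differences \<open>A1 - A2\<close> and \<open>B1 - B2\<close> is a
  linear relation between states and inputs that holds at all times below \<open>T\<close>, hence is
  trivial by the fundamental lemma.\<close>

lemma state_input_map_unique:
  assumes A: "A \<in> carrier_mat n n" and B: "B \<in> carrier_mat n m"
    and ctrl: "controllable n m A B" and tr: "trajectory n m A B T u x"
    and pe: "persistently_exciting m (n + 1) T u"
    and A1: "A1 \<in> carrier_mat l n" and B1: "B1 \<in> carrier_mat l m"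
    and A2: "A2 \<in> carrier_mat l n" and B2: "B2 \<in> carrier_mat l m"
    and eq: "\<And>k. k < T \<Longrightarrow> A1 *\<^sub>v x k + B1 *\<^sub>v u k = A2 *\<^sub>v x k + B2 *\<^sub>v u k"
  shows "A1 = A2" "B1 = B2"
proof -
  have u: "u k \<in> carrier_vec m" if "k < T" for k using tr that by (simp add: trajectory_def)
  have x: "x k \<in> carrier_vec n" if "k \<le> T" for k using tr that by (simp add: trajectory_def)
  have rows: "row A1 i = row A2 i \<and> row B1 i = row B2 i" if i: "i < l" for i
  proof -
    let ?\<xi> = "row A1 i - row A2 i" and ?\<eta> = "row B1 i - row B2 i"
    have r: "row A1 i \<in> carrier_vec n" "row A2 i \<in> carrier_vec n"
        "row B1 i \<in> carrier_vec m" "row B2 i \<in> carrier_vec m"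
      using A1 A2 B1 B2 by auto
    have rel: "?\<xi> \<bullet> x k + ?\<eta> \<bullet> u k = 0" if k: "k < T" for k
    proof -
      have "(A1 *\<^sub>v x k + B1 *\<^sub>v u k) $ i = (A2 *\<^sub>v x k + B2 *\<^sub>v u k) $ i"
        using eq[OF k] by simp
      then have "row A1 i \<bullet> x k + row B1 i \<bullet> u k = row A2 i \<bullet> x k + row B2 i \<bullet> u k"
        using i A1 A2 B1 B2 by simp
      then show ?thesis
        using r x[of k] u[of k] k by (simp add: minus_scalar_prod_distrib[of _ n]
            minus_scalar_prod_distrib[of _ m])
    qed
    have "?\<xi> = 0\<^sub>v n" "?\<eta> = 0\<^sub>v m"
      using state_input_data_left_kernel_trivial[OF A B ctrl tr pe _ _ rel] r by auto
    moreover have "v = w" if "v - w = 0\<^sub>v q" "v \<in> carrier_vec q" "w \<in> carrier_vec q"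
      for v w :: "real vec" and q
    proof (rule eq_vecI)
      fix j assume "j < dim_vec w"
      then have "(v - w) $ j = 0" "j < dim_vec w" using that by auto
      then show "v $ j = w $ j" by simp
    qed (use that in auto)
    ultimately show ?thesis using r by blast
  qed
  show "A1 = A2" using rows A1 A2 by (intro eq_rowI) auto
  show "B1 = B2" using rows B1 B2 by (intro eq_rowI) auto
qed

section \<open>Consistency with the poisoned data, column by column\<close>

lemma data_mat_carrier [simp]: "data_mat q s T w \<in> carrier_mat q T"
  by (simp add: data_mat_def mat_of_cols_def)

lemma col_data_mat:
  "k < T \<Longrightarrow> w (s + k) \<in> carrier_vec q \<Longrightarrow> col (data_mat q s T w) k = w (s + k)"
  by (simp add: data_mat_def)

lemma poisoned_consistent_iff:
  assumes x: "\<And>k. k \<le> T \<Longrightarrow> x k \<in> carrier_vec n" and u: "\<And>k. k < T \<Longrightarrow> u k \<in> carrier_vec m"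
  shows "is_consistent_system n m (data_mat m 0 T u) (data_mat n 0 T x)
      (data_mat n 1 T x + \<delta> \<cdot>\<^sub>m data_mat n 0 T x) (A, B) \<longleftrightarrow>
    A \<in> carrier_mat n n \<and> B \<in> carrier_mat n m \<and>
    (\<forall>k<T. x (Suc k) + \<delta> \<cdot>\<^sub>v x k = A *\<^sub>v x k + B *\<^sub>v u k)"
proof -
  let ?U = "data_mat m 0 T u" and ?Xm = "data_mat n 0 T x" and ?Xp = "data_mat n 1 T x"
  have "?Xp + \<delta> \<cdot>\<^sub>m ?Xm = A * ?Xm + B * ?U \<longleftrightarrow>
      (\<forall>k<T. x (Suc k) + \<delta> \<cdot>\<^sub>v x k = A *\<^sub>v x k + B *\<^sub>v u k)" (is "?L = ?R \<longleftrightarrow> _")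
    if A: "A \<in> carrier_mat n n" and B: "B \<in> carrier_mat n m"
  proof -
    have L: "?L \<in> carrier_mat n T" and R: "?R \<in> carrier_mat n T"
      using A B by (auto intro!: add_carrier_mat mult_carrier_mat[of _ n n] mult_carrier_mat[of _ n m])
    \<comment> \<open>Column \<open>k\<close> of \<open>?Xp\<close> is the sample at
      \<open>Suc k\<close>, because that matrix starts at time 1.\<close>
    have cU: "col ?U k = u k" and cm: "col ?Xm k = x k" and cp: "col ?Xp k = x (Suc k)"
      if "k < T" for k
      using that x u by (simp_all add: col_data_mat)
    have cols: "col ?L k = x (Suc k) + \<delta> \<cdot>\<^sub>v x k" "col ?R k = A *\<^sub>v x k + B *\<^sub>v u k"
      if k: "k < T" for k
    proof -
      have smult: "col (\<delta> \<cdot>\<^sub>m ?Xm) k = \<delta> \<cdot>\<^sub>v col ?Xm k"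
        using k carrier_matD(2)[OF data_mat_carrier[of n 0 T x]] by (intro col_smult) simp
      show "col ?L k = x (Suc k) + \<delta> \<cdot>\<^sub>v x k"
        using col_add[OF data_mat_carrier[of n 1 T x]
            smult_carrier_mat[OF data_mat_carrier[of n 0 T x]] k] smult cm[OF k] cp[OF k]
        by simp
      have "col (A * ?Xm) k = A *\<^sub>v x k" "col (B * ?U) k = B *\<^sub>v u k"
        using col_mult2[OF A data_mat_carrier k] col_mult2[OF B data_mat_carrier k] cm[OF k] cU[OF k]
        by simp_all
      then show "col ?R k = A *\<^sub>v x k + B *\<^sub>v u k"
        using col_add[OF mult_carrier_mat[OF A data_mat_carrier[of n 0 T x]]
            mult_carrier_mat[OF B data_mat_carrier[of m 0 T u]] k] by simp
    qed
    have "?L = ?R \<longleftrightarrow> (\<forall>k<T. col ?L k = col ?R k)"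
      using L R by (metis mat_col_eqI carrier_matD)
    then show ?thesis using cols by auto
  qed
  then show ?thesis by (auto simp: is_consistent_system_def)
qed

section \<open>Translation of the spectrum\<close>

lemma smult_one_mat_mult_vec:
  fixes v :: "'a :: comm_ring_1 vec"
  assumes "v \<in> carrier_vec n"
  shows "(c \<cdot>\<^sub>m 1\<^sub>m n) *\<^sub>v v = c \<cdot>\<^sub>v v"
  using assms by (intro eq_vecI) auto

lemma eigenvalue_add_smult_one:
  fixes M :: "'a :: comm_ring_1 mat"
  assumes M: "M \<in> carrier_mat n n" and "eigenvalue M \<mu>"
  shows "eigenvalue (M + c \<cdot>\<^sub>m 1\<^sub>m n) (\<mu> + c)"
proof -
  obtain v where v: "v \<in> carrier_vec n" "v \<noteq> 0\<^sub>v n" "M *\<^sub>v v = \<mu> \<cdot>\<^sub>v v"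
    using assms by (auto simp: eigenvalue_def eigenvector_def)
  have "(M + c \<cdot>\<^sub>m 1\<^sub>m n) *\<^sub>v v = (\<mu> + c) \<cdot>\<^sub>v v"
    using M v by (simp add: add_mult_distrib_mat_vec[of _ n n] smult_one_mat_mult_vec add_smult_distrib_vec)
  then show ?thesis
    using M v unfolding eigenvalue_def eigenvector_def by auto
qed

text \<open>If \<mu> and \<mu> + \<delta> both lie in the open unit disc, their difference has
  modulus below 2. Positive size guarantees that a complex eigenvalue \<mu> exists.\<close>

lemma schur_stable_shift_bound:
  assumes M: "M \<in> carrier_mat n n" and n: "n > 0"
    and st: "schur_stable M" and st': "schur_stable (M + \<delta> \<cdot>\<^sub>m 1\<^sub>m n)"
  shows "\<bar>\<delta>\<bar> < 2"
proof -
  let ?C = "map_mat complex_of_real"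
  have C: "?C M \<in> carrier_mat n n" using M by simp
  obtain \<mu> where \<mu>: "eigenvalue (?C M) \<mu>"
    using spectrum_non_empty[OF C n] by (auto simp: spectrum_def)
  have "?C (M + \<delta> \<cdot>\<^sub>m 1\<^sub>m n) = ?C M + complex_of_real \<delta> \<cdot>\<^sub>m 1\<^sub>m n"
    using M by (intro eq_matI) auto
  then have "cmod \<mu> < 1" "cmod (\<mu> + of_real \<delta>) < 1"
    using st st' \<mu> eigenvalue_add_smult_one[OF C \<mu>, of "of_real \<delta>"]
    by (auto simp: schur_stable_def)
  moreover have "cmod (of_real \<delta>) \<le> cmod (\<mu> + of_real \<delta>) + cmod \<mu>"
    using norm_triangle_ineq4[of "\<mu> + of_real \<delta>" \<mu>] by simp
  ultimately show ?thesis by simp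
qed

section \<open>Destabilization through the poisoned data\<close>

theorem theorem1:
  fixes n m T :: nat
    and A B :: "real mat"
    and u x :: "nat \<Rightarrow> real vec"
    and \<delta> :: real
    and U Xm Xp Xm' Xp' :: "real mat"
  assumes "n \<ge> 1" and "m \<ge> 1" and "T \<ge> 1"
    and "A \<in> carrier_mat n n" and "B \<in> carrier_mat n m"
    and "controllable n m A B"
    and "trajectory n m A B T u x"
    and "persistently_exciting m (n + 1) T u"
    and "\<bar>\<delta>\<bar> \<ge> 2"
    and "U = data_mat m 0 T u"
    and "Xm = data_mat n 0 T x"
    and "Xp = data_mat n 1 T x"
    and "Xp' = Xp + \<delta> \<cdot>\<^sub>m Xm"
    and "Xm' = Xm"
  shows "(\<exists>!S. is_consistent_system n m U Xm' Xp' S) \<and>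
    (\<forall>K \<in> carrier_mat m n.
       stabilizes K (consistent_system n m U Xm' Xp') \<longrightarrow> \<not> schur_stable (A + B * K))"
proof -
  let ?A = "A + \<delta> \<cdot>\<^sub>m 1\<^sub>m n"
  let ?C = "is_consistent_system n m U Xm' Xp'"
  have n: "n > 0" using assms(1) by simp
  note A = assms(4) and B = assms(5) and ctrl = assms(6) and tr = assms(7) and pe = assms(8)
  have u: "u k \<in> carrier_vec m" if "k < T" for k using tr that by (simp add: trajectory_def)
  have x: "x k \<in> carrier_vec n" if "k \<le> T" for k using tr that by (simp add: trajectory_def)
  have step: "x (Suc k) = A *\<^sub>v x k + B *\<^sub>v u k" if "k < T" for k
    using tr that by (simp add: trajectory_def)
  have A': "?A \<in> carrier_mat n n" using A by simp
  have iff: "?C (A', B') \<longleftrightarrow> A' \<in> carrier_mat n n \<and> B' \<in> carrier_mat n m \<and>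
      (\<forall>k<T. x (Suc k) + \<delta> \<cdot>\<^sub>v x k = A' *\<^sub>v x k + B' *\<^sub>v u k)" for A' B'
    using poisoned_consistent_iff[of T x n u m \<delta> A' B'] x u assms(10-14) by simp
  have poisoned_step: "x (Suc k) + \<delta> \<cdot>\<^sub>v x k = ?A *\<^sub>v x k + B *\<^sub>v u k" if k: "k < T" for k
  proof -
    have xk: "x k \<in> carrier_vec n" and uk: "u k \<in> carrier_vec m" using x u k by auto
    have c: "A *\<^sub>v x k \<in> carrier_vec n" "B *\<^sub>v u k \<in> carrier_vec n"
      using A B xk uk by (auto intro: mult_mat_vec_carrier)
    have "?A *\<^sub>v x k = A *\<^sub>v x k + \<delta> \<cdot>\<^sub>v x k"
      using A xk by (simp add: add_mult_distrib_mat_vec[of _ n n] smult_one_mat_mult_vec)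
    moreover have "a + b + d = a + d + b"
      if "a \<in> carrier_vec n" "b \<in> carrier_vec n" "d \<in> carrier_vec n" for a b d :: "real vec"
      using that by (intro eq_vecI) auto
    ultimately show ?thesis
      using step[OF k] c xk by simp
  qed
  have cons: "?C (?A, B)"
    using iff A' B poisoned_step by simp
  \<comment> \<open>The attack leaves \<open>Xm\<close> and \<open>U\<close> unchanged, so the
    fundamental lemma for the true trajectory still applies: two consistent pairs agree on all
    samples and therefore coincide.\<close>
  have uniq: "S = (?A, B)" if "?C S" for S
  proof -
    obtain A1 B1 where S: "S = (A1, B1)" by (cases S)
    have A1: "A1 \<in> carrier_mat n n" and B1: "B1 \<in> carrier_mat n m"
      and eq: "\<And>k. k < T \<Longrightarrow> A1 *\<^sub>v x k + B1 *\<^sub>v u k = ?A *\<^sub>v x k + B *\<^sub>v u k"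
      using that poisoned_step unfolding S iff by auto
    show ?thesis
      using state_input_map_unique[OF A B ctrl tr pe A1 B1 A' B eq] S by simp
  qed
  have ex1: "\<exists>!S. ?C S" using cons uniq by blast
  \<comment> \<open>Existence and uniqueness give the definite description in
    \<open>consistent_system\<close> its value.\<close>
  have system: "consistent_system n m U Xm' Xp' = (?A, B)"
    unfolding consistent_system_def using cons uniq by (rule the_equality)
  have "\<not> schur_stable (A + B * K)"
    if K: "K \<in> carrier_mat m n" and stab: "stabilizes K (consistent_system n m U Xm' Xp')" for K
  proof
    assume st: "schur_stable (A + B * K)"
    have BK: "B * K \<in> carrier_mat n n" using B K by simp
    \<comment> \<open>The closed loop seen by the designer is the true closed loop translated by
      \<delta>.\<close>
    have "?A + B * K = (A + B * K) + \<delta> \<cdot>\<^sub>m 1\<^sub>m n"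
      using A BK comm_add_mat[of "\<delta> \<cdot>\<^sub>m 1\<^sub>m n" n n "B * K"]
      by (simp add: assoc_add_mat[of _ n n])
    then have "schur_stable ((A + B * K) + \<delta> \<cdot>\<^sub>m 1\<^sub>m n)"
      using stab by (simp add: stabilizes_def system)
    then have "\<bar>\<delta>\<bar> < 2"
      using schur_stable_shift_bound[OF _ n st] A BK by simp
    with assms(9) show False by simp
  qed
  with ex1 show ?thesis by blast
qed

end
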